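(* For any graph $G$ and any integer $r$ satisfying $3\leq r\leq\omega(G)$, we have $$\rho_r(G)\leq\rho(\widetilde{G})^{r-1}\binom{\omega(G)-1}{r-1}(\omega(G)-1)^{-(r-1)},$$ where $\widetilde{G}$ is the subgraph of $G$ obtained by deleting all edges that are not contained in an $r$-clique of $G$.
   Context: Graphs are finite and simple. A clique of $G$ is a set of vertices inducing a complete graph; an $r$-clique is a clique with $r$ vertices; $C_r(G)$ is the set of $r$-cliques of $G$; $\omega(G)$ is the maximum size of a clique. For a graph $G$, $\rho(G)$ is the spectral radius of its adjacency matrix. The $r$-clique tensor $\mathcal{A}_r(G)=(a_{i_1\cdots i_r})$ is the $r$-order $|V(G)|$-dimension tensor with $a_{i_1\cdots i_r}=\frac{1}{(r-1)!}$ if $\{i_1,\ldots,i_r\}\in C_r(G)$ and $0$ otherwise. For an $m$-order $n$-dimension tensor $\mathcal{A}=(a_{i_1\cdots i_m})$ and $x\in\mathbb{C}^n$, $\mathcal{A}x^{m-1}\in\mathbb{C}^n$ is the vector with $i$-th component $\sum_{i_2,\ldots,i_m=1}^n a_{ii_2\cdots i_m}x_{i_2}\cdots x_{i_m}$; $\lambda\in\mathbb{C}$ is an eigenvalue of $\mathcal{A}$ if $\mathcal{A}x^{m-1}=\lambda x^{[m-1]}$ for some nonzero $x\in\mathbb{C}^n$, where $x^{[m-1]}=(x_1^{m-1},\ldots,x_n^{m-1})^\top$; the spectral radius of $\mathcal{A}$ is the largest modulus of its eigenvalues. The $r$-clique spectral radius $\rho_r(G)$ is the spectral radius of $\mathcal{A}_r(G)$.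 *)

theory Defs
  imports
    "HOL-Library.Ramsey"
    "HOL-Library.Countable_Set"
    "Jordan_Normal_Form.Spectral_Radius"
begin

subsection \<open>Graphs and cliques\<close>

text \<open>Graphs have vertex set \<open>V\<close> and edge set \<open>E\<close>, a set of two-element subsets of \<open>V\<close>.
  The predicate \<^const>\<open>clique\<close> comes from \<^theory>\<open>HOL-Library.Ramsey\<close>.\<close>

definition finite_simple_graph :: "'a set \<Rightarrow> 'a set set \<Rightarrow> bool" where
  "finite_simple_graph V E \<longleftrightarrow> finite V \<and> E \<subseteq> nsets V 2"

definition r_cliques :: "nat \<Rightarrow> 'a set \<Rightarrow> 'a set set \<Rightarrow> 'a set set" where
  "r_cliques r V E = {K. K \<subseteq> V \<and> finite K \<and> card K = r \<and> clique K E}"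

definition clique_number :: "'a set \<Rightarrow> 'a set set \<Rightarrow> nat" where
  "clique_number V E = Max (card ` {K. K \<subseteq> V \<and> clique K E})"

definition edges_in_r_cliques :: "nat \<Rightarrow> 'a set \<Rightarrow> 'a set set \<Rightarrow> 'a set set" where
  "edges_in_r_cliques r V E = {e \<in> E. \<exists>K \<in> r_cliques r V E. e \<subseteq> K}"

subsection \<open>The adjacency matrix\<close>

text \<open>Matrices and tensors are indexed by \<open>{..<card V}\<close>. The vertices are numbered by
  \<^term>\<open>from_nat_into V\<close>, which for finite \<open>V\<close> is a bijection from \<open>{..<card V}\<close> onto \<open>V\<close>
  (\<open>bij_betw_from_nat_into_finite\<close>); eigenvalues do not depend on the numbering.\<close>

definition adjacency_matrix :: "'a set \<Rightarrow> 'a set set \<Rightarrow> complex mat" where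
  "adjacency_matrix V E = mat (card V) (card V)
     (\<lambda>(i, j). if {from_nat_into V i, from_nat_into V j} \<in> E then 1 else 0)"

definition graph_spectral_radius :: "'a set \<Rightarrow> 'a set set \<Rightarrow> real" where
  "graph_spectral_radius V E = spectral_radius (adjacency_matrix V E)"

subsection \<open>Tensors\<close>

text \<open>A tensor of order \<open>m\<close> and dimension \<open>n\<close> is a function on index lists, of which only the values
  at lists of length \<open>m\<close> with entries below \<open>n\<close> matter.\<close>

type_synonym tensor = "nat list \<Rightarrow> complex"

definition tensor_apply :: "nat \<Rightarrow> nat \<Rightarrow> tensor \<Rightarrow> complex vec \<Rightarrow> complex vec" where
  "tensor_apply m n A x = vec n (\<lambda>i.
     \<Sum>js \<in> {js. length js = m - 1 \<and> set js \<subseteq> {..<n}}. A (i # js) * (\<Prod>j\<leftarrow>js. x $ j))"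

definition tensor_eigenvalue :: "nat \<Rightarrow> nat \<Rightarrow> tensor \<Rightarrow> complex \<Rightarrow> bool" where
  "tensor_eigenvalue m n A \<mu> \<longleftrightarrow>
     (\<exists>x \<in> carrier_vec n. x \<noteq> 0\<^sub>v n \<and>
        tensor_apply m n A x = \<mu> \<cdot>\<^sub>v map_vec (\<lambda>z. z ^ (m - 1)) x)"

text \<open>The largest modulus is taken as a supremum, because \<^const>\<open>Max\<close> is meaningful only once the set
  of eigenvalues is known to be finite. The lemma below confirms that it is the largest modulus
  whenever that is attained.\<close>

definition tensor_spectral_radius :: "nat \<Rightarrow> nat \<Rightarrow> tensor \<Rightarrow> real" where
  "tensor_spectral_radius m n A = Sup (norm ` Collect (tensor_eigenvalue m n A))"

lemma tensor_spectral_radius_eq: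
  assumes "tensor_eigenvalue m n A \<mu>"
    and "\<And>\<nu>. tensor_eigenvalue m n A \<nu> \<Longrightarrow> norm \<nu> \<le> norm \<mu>"
  shows "tensor_spectral_radius m n A = norm \<mu>"
  unfolding tensor_spectral_radius_def by (rule cSup_eq_maximum) (use assms in auto)

text \<open>As members of \<^const>\<open>r_cliques\<close> have exactly \<open>r\<close> elements, an entry with a repeated index
  is \<open>0\<close>.\<close>

definition clique_tensor :: "nat \<Rightarrow> 'a set \<Rightarrow> 'a set set \<Rightarrow> tensor" where
  "clique_tensor r V E idx =
     (if from_nat_into V ` set idx \<in> r_cliques r V E then 1 / fact (r - 1) else 0)"

definition clique_spectral_radius :: "nat \<Rightarrow> 'a set \<Rightarrow> 'a set set \<Rightarrow> real" where
  "clique_spectral_radius r V E = tensor_spectral_radius r (card V) (clique_tensor r V E)"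

end

theory Submission
  imports Defs "HOL-Combinatorics.Multiset_Permutations"
begin

text \<open>Let \<open>\<mu>\<close> be an eigenvalue of the clique tensor with eigenvector \<open>x\<close>, and put \<open>y\<^sub>i = \<bar>x\<^sub>i\<bar>\<close> and
  \<open>\<omega> = \<omega>(G)\<close>. Then \<open>\<bar>\<mu>\<bar> y\<^sub>i^(r-1)\<close> is at most the weighted number of \<open>(r-1)\<close>-cliques in the
  neighbourhood of \<open>i\<close> in the reduced graph, whose cliques have at most \<open>\<omega> - 1\<close> vertices. By the weighted
  Motzkin--Straus inequality this is at most
  \<open>(\<omega>-1 choose r-1) ((A y)\<^sub>i / (\<omega>-1))^(r-1)\<close> with \<open>A\<close> the adjacency matrix of the reduced graph. Taking
  roots gives \<open>c y \<le> A y\<close> entrywise, where \<open>\<bar>\<mu>\<bar> = (\<omega>-1 choose r-1) (c / (\<omega>-1))^(r-1)\<close>; by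
  Collatz--Wielandt \<open>c \<le> \<rho>(A)\<close>.\<close>

section \<open>Weighted clique sums\<close>

text \<open>If \<open>V\<close> is a clique, this is the elementary symmetric polynomial of degree
  \<open>s\<close> in the weights; in general only its monomials supported on cliques are
  kept.\<close>

definition clique_sum :: "'a set set \<Rightarrow> ('a \<Rightarrow> real) \<Rightarrow> 'a set \<Rightarrow> nat \<Rightarrow> real" where
  "clique_sum E z V s = (\<Sum>K\<in>r_cliques s V E. \<Prod>v\<in>K. z v)"

lemma finite_r_cliques: "finite V \<Longrightarrow> finite (r_cliques s V E)"
  by (rule finite_subset[of _ "Pow V"]) (auto simp: r_cliques_def)

lemma clique_sum_0 [simp]: "clique_sum E z V 0 = 1"
proof -
  have "r_cliques 0 V E = {{}}"
    by (auto simp: r_cliques_def clique_def)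
  then show ?thesis by (simp add: clique_sum_def)
qed

lemma clique_sum_cong:
  assumes "\<And>v. v \<in> V \<Longrightarrow> z v = z' v"
  shows "clique_sum E z V s = clique_sum E z' V s"
  unfolding clique_sum_def
  by (intro sum.cong prod.cong) (use assms in \<open>auto simp: r_cliques_def\<close>)

lemma clique_sum_nonneg:
  assumes "\<And>v. v \<in> V \<Longrightarrow> 0 \<le> z v"
  shows "0 \<le> clique_sum E z V s"
  unfolding clique_sum_def
  by (intro sum_nonneg prod_nonneg) (use assms in \<open>auto simp: r_cliques_def\<close>)

lemma r_cliques_Suc_insert:
  assumes "finite V" "v \<notin> V"
  shows "r_cliques (Suc s) (insert v V) E =
    r_cliques (Suc s) V E \<union> insert v ` r_cliques s {u \<in> V. {v, u} \<in> E} E" (is "?L = ?R")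
proof (intro equalityI subsetI)
  fix K assume K: "K \<in> ?L"
  show "K \<in> ?R"
  proof (cases "v \<in> K")
    case True
    then have "K - {v} \<in> r_cliques s {u \<in> V. {v, u} \<in> E} E"
      using K by (auto simp: r_cliques_def clique_def)
    moreover have "K = insert v (K - {v})"
      using True by auto
    ultimately show ?thesis by blast
  next
    case False
    then show ?thesis using K by (auto simp: r_cliques_def)
  qed
next
  fix K assume "K \<in> ?R"
  then show "K \<in> ?L"
  proof
    assume "K \<in> r_cliques (Suc s) V E"
    then show ?thesis by (auto simp: r_cliques_def)
  next
    assume "K \<in> insert v ` r_cliques s {u \<in> V. {v, u} \<in> E} E"
    then obtain L where L: "K = insert v L" "L \<subseteq> {u \<in> V. {v, u} \<in> E}" "finite L" "card L = s" "clique L E"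
      by (auto simp: r_cliques_def)
    have "v \<notin> L" using L(2) assms(2) by auto
    moreover have "clique K E"
      using L(2,5) unfolding clique_def L(1) by (auto simp: insert_commute)
    ultimately show ?thesis
      using L by (auto simp: r_cliques_def)
  qed
qed

text \<open>A clique either avoids \<open>v\<close> or is \<open>v\<close> joined to a smaller
  clique among its neighbours. Used at two vertices in turn, the recurrence isolates the dependence
  on their two weights.\<close>

lemma clique_sum_Suc_insert:
  assumes "finite V" "v \<notin> V"
  shows "clique_sum E z (insert v V) (Suc s) =
    clique_sum E z V (Suc s) + z v * clique_sum E z {u \<in> V. {v, u} \<in> E} s"
proof -
  let ?N = "{u \<in> V. {v, u} \<in> E}"
  have notin: "v \<notin> K" if "K \<in> r_cliques s ?N E" for K
    using that assms(2) by (auto simp: r_cliques_def)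
  have fin: "finite K" if "K \<in> r_cliques s ?N E" for K
    using that by (auto simp: r_cliques_def)
  have "clique_sum E z (insert v V) (Suc s) = clique_sum E z V (Suc s)
      + (\<Sum>K\<in>insert v ` r_cliques s ?N E. \<Prod>u\<in>K. z u)"
    unfolding clique_sum_def r_cliques_Suc_insert[OF assms]
    by (rule sum.union_disjoint) (use assms in \<open>auto simp: finite_r_cliques, auto simp: r_cliques_def\<close>)
  also have "(\<Sum>K\<in>insert v ` r_cliques s ?N E. \<Prod>u\<in>K. z u)
      = (\<Sum>K\<in>r_cliques s ?N E. z v * (\<Prod>u\<in>K. z u))"
  proof (subst sum.reindex)
    show "inj_on (insert v) (r_cliques s ?N E)"
      by (rule inj_onI) (metis insert_ident notin)
  qed (use notin fin in \<open>auto intro!: sum.cong\<close>)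
  finally show ?thesis by (simp add: clique_sum_def sum_distrib_left)
qed

section \<open>Maclaurin's inequality for weights on a clique\<close>

text \<open>Cliques are sorted by how many of \<open>i\<close>, \<open>j\<close> they contain; both
  vertices see all of \<open>W\<close>, so the coefficients come from \<open>W\<close> alone. As
  \<open>c\<close> is nonnegative, for a fixed \<open>p + q\<close> the sum grows with
  \<open>p * q\<close>.\<close>

lemma clique_sum_insert2_clique:
  assumes "finite W" "i \<notin> W" "j \<notin> W" "i \<noteq> j" "clique (insert i (insert j W)) E"
    and "\<And>v. v \<in> W \<Longrightarrow> 0 \<le> z v"
  obtains a b c where "0 \<le> c"
    and "\<And>p q. clique_sum E (z(i := p, j := q)) (insert i (insert j W)) s = a + (p + q) * b + p * q * c"
proof (cases s)
  case 0
  \<comment> \<open>The witnesses are listed in the order \<open>c\<close>, \<open>a\<close>,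
    \<open>b\<close>, here and below.\<close>
  show ?thesis by (rule that[of 0 1 0]) (simp_all add: 0)
next
  case (Suc t)
  have Ni: "{u \<in> insert j W. {i, u} \<in> E} = insert j W" and Nj: "{u \<in> W. {j, u} \<in> E} = W"
    using assms(2-5) by (auto simp: clique_def)
  have W: "clique_sum E (z(i := p, j := q)) W m = clique_sum E z W m" for p q m
    by (rule clique_sum_cong) (use assms(2,3) in auto)
  have rec: "clique_sum E z' (insert j W) (Suc m) = clique_sum E z' W (Suc m) + z' j * clique_sum E z' W m"
    for z' m using assms(1,3) by (simp add: clique_sum_Suc_insert Nj)
  have iW: "finite (insert j W)" "i \<notin> insert j W"
    using assms(1,2,4) by auto
  have eq: "clique_sum E z' (insert i (insert j W)) s =
      clique_sum E z' W (Suc t) + z' j * clique_sum E z' W t + z' i * clique_sum E z' (insert j W) t" for z'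
    by (simp only: Suc clique_sum_Suc_insert[OF iW] Ni rec)
  \<comment> \<open>The recurrence applies to \<open>insert j W\<close> only at a successor index,
    so \<open>s = 1\<close> is separate: there each of the two vertices contributes just its own
    weight.\<close>
  show ?thesis
  proof (cases t)
    case 0
    show ?thesis
      by (rule that[of 0 "clique_sum E z W (Suc t)" 1]) (unfold eq W, use assms(4) 0 in simp_all)
  next
    case (Suc m)
    show ?thesis
      by (rule that[of "clique_sum E z W m" "clique_sum E z W (Suc t)" "clique_sum E z W t"])
        (unfold eq W Suc rec, use assms(4,6) in \<open>auto simp: algebra_simps clique_sum_nonneg\<close>)
  qed
qed

lemma clique_sum_const:
  assumes "finite V" "clique V E" "\<And>v. v \<in> V \<Longrightarrow> z v = c"
  shows "clique_sum E z V s = real (card V choose s) * c ^ s"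
proof -
  have eq: "r_cliques s V E = {K. K \<subseteq> V \<and> card K = s}"
    using assms(1,2) by (auto simp: r_cliques_def clique_def intro: finite_subset)
  have "clique_sum E z V s = (\<Sum>K\<in>{K. K \<subseteq> V \<and> card K = s}. c ^ s)"
    unfolding clique_sum_def eq
  proof (rule sum.cong)
    fix K assume "K \<in> {K. K \<subseteq> V \<and> card K = s}"
    then have K: "K \<subseteq> V" "card K = s" by auto
    have "(\<Prod>v\<in>K. z v) = (\<Prod>v\<in>K. c)"
      by (rule prod.cong) (use K(1) assms(3) in auto)
    with K(2) show "(\<Prod>v\<in>K. z v) = c ^ s" by simp
  qed simp
  then show ?thesis using assms(1) by (simp add: n_subsets)
qed

text \<open>Smoothing: a weight below the mean and one above it are replaced by the mean and the value
  that keeps their sum; this increases their product.\<close>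

lemma maclaurin_inequality_mean:
  assumes "finite V" "V \<noteq> {}" "clique V E" "\<And>v. v \<in> V \<Longrightarrow> 0 \<le> z v"
    and "(\<Sum>v\<in>V. z v) = real (card V) * \<mu>"
  shows "clique_sum E z V s \<le> real (card V choose s) * \<mu> ^ s"
  using assms(4,5)
\<comment> \<open>The measure counts the weights that differ from the mean.\<close>
proof (induction "card {v \<in> V. z v \<noteq> \<mu>}" arbitrary: z rule: less_induct)
  case less
  show ?case
  proof (cases "\<forall>v\<in>V. z v = \<mu>")
    case True
    then show ?thesis using clique_sum_const[OF assms(1,3), of z \<mu> s] by simp
  next
    case False
    have sum0: "(\<Sum>v\<in>V. z v - \<mu>) = 0"
      using less.prems(2) by (simp add: sum_subtractf)
    have "\<exists>i\<in>V. z i < \<mu>"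
    proof (rule ccontr)
      assume "\<not> ?thesis"
      then have "\<forall>v\<in>V. 0 \<le> z v - \<mu>" by force
      with sum0 have "\<forall>v\<in>V. z v - \<mu> = 0"
        using sum_nonneg_eq_0_iff[OF assms(1), of "\<lambda>v. z v - \<mu>"] by blast
      with False show False by simp
    qed
    then obtain i where i: "i \<in> V" "z i < \<mu>" by blast
    have "\<exists>j\<in>V. \<mu> < z j"
    proof (rule ccontr)
      assume "\<not> ?thesis"
      then have "\<forall>v\<in>V. 0 \<le> \<mu> - z v" by force
      moreover have "(\<Sum>v\<in>V. \<mu> - z v) = 0"
        using less.prems(2) by (simp add: sum_subtractf)
      ultimately have "\<forall>v\<in>V. \<mu> - z v = 0"
        using sum_nonneg_eq_0_iff[OF assms(1), of "\<lambda>v. \<mu> - z v"] by blast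
      with False show False by simp
    qed
    then obtain j where j: "j \<in> V" "\<mu> < z j" by blast
    define W where "W = V - {i, j}"
    define y where "y = z(i := \<mu>, j := z i + z j - \<mu>)"
    have ij: "i \<noteq> j" using i j by auto
    have V: "V = insert i (insert j W)" and W: "finite W" "i \<notin> W" "j \<notin> W"
      using i j assms(1) by (auto simp: W_def)
    have cl: "clique (insert i (insert j W)) E" and nonneg: "\<And>v. v \<in> W \<Longrightarrow> 0 \<le> z v"
      using assms(3) less.prems(1) V by auto
    obtain a b c where c: "0 \<le> c"
      and abc: "\<And>p q. clique_sum E (z(i := p, j := q)) V s = a + (p + q) * b + p * q * c"
    proof (rule clique_sum_insert2_clique[OF W ij cl nonneg, where s = s])
      fix a b c
      assume *: "0 \<le> c" "\<And>p q. clique_sum E (z(i := p, j := q)) (insert i (insert j W)) s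
        = a + (p + q) * b + p * q * c"
      show thesis by (rule that[OF *(1)]) (unfold V, rule *(2))
    qed
    have \<mu>: "0 \<le> \<mu>" using i less.prems(1)[of i] by simp
    \<comment> \<open>Expanded, this says that the new pair of weights has at least the product of
      the old pair.\<close>
    have "0 \<le> (\<mu> - z i) * (z j - \<mu>)" using i j by simp
    then have "z i * z j \<le> \<mu> * (z i + z j - \<mu>)" by (simp add: algebra_simps)
    then have "z i * z j * c \<le> \<mu> * (z i + z j - \<mu>) * c"
      using c by (rule mult_right_mono)
    then have "clique_sum E z V s \<le> clique_sum E y V s"
      using abc[of "z i" "z j"] abc[of \<mu> "z i + z j - \<mu>"] by (simp add: y_def)
    also have "\<dots> \<le> real (card V choose s) * \<mu> ^ s"
    proof (rule less.hyps)
      \<comment> \<open>The vertex \<open>i\<close> leaves the set, and \<open>j\<close> was already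
        in it, so the measure drops whatever the new weight of \<open>j\<close> is.\<close>
      have "{v \<in> V. y v \<noteq> \<mu>} \<subset> {v \<in> V. z v \<noteq> \<mu>}"
        using i j ij by (auto simp: y_def split: if_splits)
      then show "card {v \<in> V. y v \<noteq> \<mu>} < card {v \<in> V. z v \<noteq> \<mu>}"
        using assms(1) by (intro psubset_card_mono) auto
      show "0 \<le> y v" if "v \<in> V" for v
        using that \<mu> i j less.prems(1)[of i] less.prems(1)[OF that] by (auto simp: y_def)
      have "(\<Sum>v\<in>W. y v) = (\<Sum>v\<in>W. z v)"
        by (rule sum.cong) (use W in \<open>auto simp: y_def\<close>)
      then have "(\<Sum>v\<in>V. y v) = (\<Sum>v\<in>V. z v)"
        unfolding V using W ij by (simp add: y_def)
      then show "(\<Sum>v\<in>V. y v) = real (card V) * \<mu>"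
        using less.prems(2) by simp
    qed
    finally show ?thesis .
  qed
qed

section \<open>The weighted Motzkin-Straus inequality\<close>

text \<open>The quotient is the product of the factors \<open>1 - l / m\<close> over
  \<open>l < s\<close>, divided by \<open>s!\<close>, and each factor grows with \<open>m\<close>.
  This replaces the size of an actual clique by the upper bound \<open>k\<close>.\<close>

lemma choose_over_power_mono:
  assumes "0 < m" "m \<le> k"
  shows "real (m choose s) / real m ^ s \<le> real (k choose s) / real k ^ s"
proof (induction s)
  case 0
  show ?case by simp
next
  case (Suc s)
  have step: "real (l choose Suc s) / real l ^ Suc s
      = real (l choose s) / real l ^ s * (real (l - s) / real l) / real (Suc s)" for l
  proof -
    have "Suc s * (l choose Suc s) = (l - s) * (l choose s)"
      by (simp only: binomial_absorption binomial_absorb_comp)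
    then have "real (Suc s) * real (l choose Suc s) = real (l - s) * real (l choose s)"
      by (metis of_nat_mult)
    then have "real (l choose Suc s) = real (l choose s) * real (l - s) / real (Suc s)"
      by (simp add: field_simps del: of_nat_Suc)
    then show ?thesis by simp
  qed
  \<comment> \<open>For \<open>s > m\<close> truncated subtraction makes the left side 0; otherwise
    this compares \<open>1 - s / m\<close> with \<open>1 - s / k\<close>.\<close>
  have "real (m - s) / real m \<le> real (k - s) / real k"
  proof (cases "s \<le> m")
    case True
    then have "real (m - s) * real k \<le> real (k - s) * real m"
      using assms mult_right_mono[of "real m" "real k" "real s"] by (simp add: of_nat_diff algebra_simps)
    then show ?thesis using assms by (simp add: field_simps)
  qed simp
  then have "real (m choose s) / real m ^ s * (real (m - s) / real m)
      \<le> real (k choose s) / real k ^ s * (real (k - s) / real k)"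
    by (intro mult_mono Suc) auto
  then show ?case unfolding step by (intro divide_right_mono) auto
qed

text \<open>If \<open>i\<close> and \<open>j\<close> are not adjacent, no clique contains both, so the clique sum is affine in
  \<open>(z i, z j)\<close> and does not decrease when one of the two weights is moved to the other vertex.\<close>

theorem weighted_motzkin_straus:
  assumes "finite V" "\<And>v. v \<in> V \<Longrightarrow> 0 \<le> z v" "\<And>K. K \<subseteq> V \<Longrightarrow> clique K E \<Longrightarrow> card K \<le> k"
  shows "clique_sum E z V s \<le> real (k choose s) * ((\<Sum>v\<in>V. z v) / real k) ^ s"
  using assms
proof (induction "card V" arbitrary: V z rule: less_induct)
  case less
  show ?case
  proof (cases s)
    case 0
    then show ?thesis by simp
  next
    case (Suc t)
    show ?thesis
    proof (cases "clique V E")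
      case True
      show ?thesis
      proof (cases "V = {}")
        case True
        then have "r_cliques s V E = {}" using Suc by (auto simp: r_cliques_def)
        then show ?thesis using True by (simp add: clique_sum_def)
      next
        case False
        define m where "m = card V"
        have m: "0 < m" "m \<le> k"
          using False less.prems(1,3) True by (auto simp: m_def card_gt_0_iff)
        have "clique_sum E z V s \<le> real (m choose s) * ((\<Sum>v\<in>V. z v) / real m) ^ s"
          unfolding m_def
          by (rule maclaurin_inequality_mean) (use less.prems True False in auto)
        also have "\<dots> = real (m choose s) / real m ^ s * (\<Sum>v\<in>V. z v) ^ s"
          by (simp add: power_divide)
        also have "\<dots> \<le> real (k choose s) / real k ^ s * (\<Sum>v\<in>V. z v) ^ s"
          by (intro mult_right_mono choose_over_power_mono m zero_le_power sum_nonneg less.prems)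
        finally show ?thesis by (simp add: power_divide)
      qed
    next
      case False
      then obtain i0 j0 where ij0: "i0 \<in> V" "j0 \<in> V" "i0 \<noteq> j0" "{i0, j0} \<notin> E"
        by (auto simp: clique_def)
      \<comment> \<open>For either vertex of the pair, this is the coefficient of its weight in the
        clique sum. The vertex with the larger coefficient is then named \<open>i\<close> and
        receives both weights; \<open>j\<close> is deleted, so the induction on
        \<open>card V\<close> applies.\<close>
      define d where "d i = clique_sum E z {u \<in> V - {i0, j0}. {i, u} \<in> E} t" for i
      obtain i j where ij: "i \<in> V" "j \<in> V" "i \<noteq> j" "{i, j} \<notin> E" "{i, j} = {i0, j0}" "d j \<le> d i"
      proof (cases "d j0 \<le> d i0")
        case True
        then show ?thesis using that[of i0 j0] ij0 by simp
      next
        case False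
        then show ?thesis using that[of j0 i0] ij0 by (simp add: insert_commute)
      qed
      define W where "W = V - {i, j}"
      have V: "V = insert i (insert j W)" and W: "finite W" "i \<notin> W" "j \<notin> W"
        using ij less.prems(1) by (auto simp: W_def)
      have d: "d l = clique_sum E z {u \<in> W. {l, u} \<in> E} t" for l
        unfolding d_def W_def ij(5) ..
      have Ni: "{u \<in> insert j W. {i, u} \<in> E} = {u \<in> W. {i, u} \<in> E}"
        using ij(4) by auto
      define y where "y = z(i := z i + z j)"
      have yW: "clique_sum E y U l = clique_sum E z U l" if "U \<subseteq> W" for U l
        by (rule clique_sum_cong) (use that W in \<open>auto simp: y_def\<close>)
      have iW: "finite (insert j W)" "i \<notin> insert j W"
        using W ij(3) by auto
      have "clique_sum E z V s = clique_sum E z W s + z j * d j + z i * d i"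
        by (simp only: V Suc d clique_sum_Suc_insert[OF iW] clique_sum_Suc_insert[OF W(1,3)] Ni)
      also have "\<dots> \<le> clique_sum E z W s + z j * d i + z i * d i"
        using ij(2,6) less.prems(2) by (simp add: mult_left_mono)
      also have "\<dots> = clique_sum E y (insert i W) s"
        unfolding Suc d using W
        by (simp add: clique_sum_Suc_insert yW) (simp add: y_def algebra_simps)
      also have "\<dots> \<le> real (k choose s) * ((\<Sum>v\<in>insert i W. y v) / real k) ^ s"
      proof (rule less.hyps)
        show "card (insert i W) < card V"
          unfolding V using W ij(3) by simp
        show "0 \<le> y v" if "v \<in> insert i W" for v
          using that less.prems(2) V ij by (auto simp: y_def)
        show "card K \<le> k" if "K \<subseteq> insert i W" "clique K E" for K
          using that less.prems(3)[of K] V by auto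
      qed (use W in auto)
      also have "(\<Sum>v\<in>insert i W. y v) = (\<Sum>v\<in>V. z v)"
      proof -
        have "(\<Sum>v\<in>W. y v) = (\<Sum>v\<in>W. z v)"
          by (rule sum.cong) (use W in \<open>auto simp: y_def\<close>)
        then show ?thesis unfolding V using W ij(3) by (simp add: y_def)
      qed
      finally show ?thesis .
    qed
  qed
qed

section \<open>A Collatz--Wielandt bound\<close>

text \<open>A nonnegative matrix preserves entrywise inequalities, so \<open>c y \<le> A y\<close>
  passes to \<open>A y\<close>, to which the induction hypothesis is applied. The matrix is complex
  for the sake of spectral theory; the real vector \<open>u\<close> lets its powers be compared
  entrywise.\<close>

lemma nonneg_mat_pow_supersolution:
  fixes a :: "nat \<Rightarrow> nat \<Rightarrow> real" and y :: "nat \<Rightarrow> real"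
  assumes "\<And>i j. 0 \<le> a i j" "0 \<le> c" "\<And>i. i < n \<Longrightarrow> c * y i \<le> (\<Sum>j<n. a i j * y j)"
  shows "\<exists>u. (mat n n (\<lambda>(i, j). complex_of_real (a i j)) ^\<^sub>m k) *\<^sub>v vec n (\<lambda>i. complex_of_real (y i))
      = vec n (\<lambda>i. complex_of_real (u i)) \<and> (\<forall>i<n. c ^ k * y i \<le> u i)"
  using assms(3)
proof (induction k arbitrary: y)
  case 0
  show ?case by (intro exI[of _ y]) simp
next
  case (Suc k)
  let ?A = "mat n n (\<lambda>(i, j). complex_of_real (a i j))"
  define y' where "y' i = (\<Sum>j<n. a i j * y j)" for i
  have A: "?A \<in> carrier_mat n n" by simp
  have Ay: "?A *\<^sub>v vec n (\<lambda>i. complex_of_real (y i)) = vec n (\<lambda>i. complex_of_real (y' i))"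
    by (rule eq_vecI) (auto simp: y'_def scalar_prod_def atLeast0LessThan)
  have "c * y' i \<le> (\<Sum>j<n. a i j * y' j)" if "i < n" for i
  proof -
    have "c * y' i = (\<Sum>j<n. a i j * (c * y j))"
      by (simp add: y'_def sum_distrib_left mult_ac)
    also have "\<dots> \<le> (\<Sum>j<n. a i j * y' j)"
      using Suc.prems assms(1) by (intro sum_mono mult_left_mono) (auto simp: y'_def)
    finally show ?thesis .
  qed
  from Suc.IH[OF this] obtain u where
    u: "(?A ^\<^sub>m k) *\<^sub>v vec n (\<lambda>i. complex_of_real (y' i)) = vec n (\<lambda>i. complex_of_real (u i))"
      "\<forall>i<n. c ^ k * y' i \<le> u i" by blast
  have "c ^ Suc k * y i \<le> u i" if "i < n" for i
  proof -
    have "c ^ Suc k * y i = c ^ k * (c * y i)" by simp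
    also have "\<dots> \<le> c ^ k * y' i"
      using Suc.prems[OF that] assms(2) by (intro mult_left_mono) (auto simp: y'_def)
    also have "\<dots> \<le> u i" using u(2) that by simp
    finally show ?thesis .
  qed
  moreover have "(?A ^\<^sub>m Suc k) *\<^sub>v vec n (\<lambda>i. complex_of_real (y i)) = vec n (\<lambda>i. complex_of_real (u i))"
    using assoc_mult_mat_vec[OF pow_carrier_mat[OF A] A, of "vec n (\<lambda>i. complex_of_real (y i))" k]
    by (simp add: Ay u(1))
  ultimately show ?case by blast
qed

lemma spectral_radius_nonneg:
  assumes "A \<in> carrier_mat n n" "0 < n"
  shows "0 \<le> spectral_radius A"
  using spectral_radius_mem_max(1)[OF assms] by auto

text \<open>An eigenvector of \<open>A / d\<close> for \<open>\<mu>\<close> is one of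
  \<open>A\<close> for \<open>d * \<mu>\<close>. With \<open>\<mu>\<close> of largest modulus,
  \<open>d * norm \<mu>\<close> is at most the spectral radius of \<open>A\<close>, hence below
  \<open>d\<close>.\<close>

lemma spectral_radius_smult_inverse_less_1:
  assumes A: "A \<in> carrier_mat n n" and "0 < n" and d: "spectral_radius A < d"
  shows "spectral_radius (complex_of_real (1 / d) \<cdot>\<^sub>m A) < 1" (is "spectral_radius ?B < 1")
proof -
  have d0: "0 < d" using spectral_radius_nonneg[OF assms(1,2)] d by simp
  have B: "?B \<in> carrier_mat n n" using A by simp
  obtain \<mu> where \<mu>: "\<mu> \<in> spectrum ?B" "spectral_radius ?B = norm \<mu>"
    using spectral_radius_mem_max(1)[OF B assms(2)] by auto
  then obtain v where v: "v \<in> carrier_vec n" "v \<noteq> 0\<^sub>v n" "?B *\<^sub>v v = \<mu> \<cdot>\<^sub>v v"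
    using A by (auto simp: spectrum_def eigenvalue_def eigenvector_def)
  have "A *\<^sub>v v = complex_of_real d \<cdot>\<^sub>v (?B *\<^sub>v v)"
    by (rule eq_vecI) (use A v(1) d0 in \<open>auto simp: scalar_prod_def sum_distrib_left mult.assoc\<close>)
  also have "\<dots> = (complex_of_real d * \<mu>) \<cdot>\<^sub>v v"
    unfolding v(3) by (simp add: smult_smult_assoc)
  finally have "complex_of_real d * \<mu> \<in> spectrum A"
    using v A by (auto simp: spectrum_def eigenvalue_def eigenvector_def)
  then have "norm (complex_of_real d * \<mu>) \<le> spectral_radius A"
    using spectral_radius_mem_max(2)[OF A assms(2)] by blast
  then have "d * norm \<mu> \<le> spectral_radius A" using d0 by (simp add: norm_mult)
  then have "d * norm \<mu> < d" using d by linarith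
  then show ?thesis
    by (metis mult.right_neutral mult_less_cancel_left_pos d0 \<mu>(2))
qed

text \<open>If \<open>\<rho>(A) < d < c\<close>, the powers of \<open>A / d\<close> are bounded, although \<open>(A / d)^k y \<ge> (c / d)^k y\<close>.\<close>

theorem collatz_wielandt_lower_bound:
  fixes a :: "nat \<Rightarrow> nat \<Rightarrow> real" and y :: "nat \<Rightarrow> real"
  assumes a: "\<And>i j. 0 \<le> a i j" and y: "\<And>i. i < n \<Longrightarrow> 0 \<le> y i"
    and i0: "i0 < n" "0 < y i0"
    and c: "\<And>i. i < n \<Longrightarrow> c * y i \<le> (\<Sum>j<n. a i j * y j)"
  shows "c \<le> spectral_radius (mat n n (\<lambda>(i, j). complex_of_real (a i j)))" (is "_ \<le> spectral_radius ?A")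
proof (rule ccontr)
  assume "\<not> ?thesis"
  then obtain d where d: "spectral_radius ?A < d" "d < c"
    using dense by (metis not_le)
  have A: "?A \<in> carrier_mat n n" and n: "0 < n" using i0 by auto
  have d0: "0 < d" using spectral_radius_nonneg[OF A n] d by simp
  \<comment> \<open>The entrywise form suits the lemma on powers; the equality with the scalar
    multiple of \<open>?A\<close> below supplies the spectral bound.\<close>
  define B where "B = mat n n (\<lambda>(i, j). complex_of_real (a i j / d))"
  have B: "B \<in> carrier_mat n n" by (simp add: B_def)
  have "B = complex_of_real (1 / d) \<cdot>\<^sub>m ?A"
    by (rule eq_matI) (auto simp: B_def)
  then have "spectral_radius B < 1"
    using spectral_radius_smult_inverse_less_1[OF A n d(1)] by simp
  then obtain M where M: "\<And>k. norm_bound (B ^\<^sub>m k) M"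
    using spectral_radius_jnf_norm_bound_less_1_upper_triangular[OF B] by blast
  \<comment> \<open>Coordinate \<open>i0\<close> of \<open>B^k y\<close> is bounded below by the
    growth of powers and above by the entry bound \<open>M\<close>, which does not depend on
    \<open>k\<close>.\<close>
  have bound: "(c / d) ^ k * y i0 \<le> (\<Sum>j<n. M * y j)" for k
  proof -
    have "c / d * y i \<le> (\<Sum>j<n. a i j / d * y j)" if "i < n" for i
      using divide_right_mono[OF c[OF that], of d] d0 by (simp add: sum_divide_distrib)
    then obtain u where u: "(B ^\<^sub>m k) *\<^sub>v vec n (\<lambda>i. complex_of_real (y i)) = vec n (\<lambda>i. complex_of_real (u i))"
        "\<forall>i<n. (c / d) ^ k * y i \<le> u i"
      using nonneg_mat_pow_supersolution[of "\<lambda>i j. a i j / d" "c / d" n y k] a d d0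
      unfolding B_def by auto
    have Bk: "B ^\<^sub>m k \<in> carrier_mat n n" using B by (rule pow_carrier_mat)
    have "complex_of_real (u i0) = ((B ^\<^sub>m k) *\<^sub>v vec n (\<lambda>i. complex_of_real (y i))) $ i0"
      unfolding u(1) using i0 by simp
    also have "\<dots> = (\<Sum>j<n. (B ^\<^sub>m k) $$ (i0, j) * complex_of_real (y j))"
      using i0 carrier_matD[OF B] carrier_matD[OF Bk] by (simp add: scalar_prod_def atLeast0LessThan)
    finally have "norm (complex_of_real (u i0)) \<le> (\<Sum>j<n. norm ((B ^\<^sub>m k) $$ (i0, j) * complex_of_real (y j)))"
      by (simp only: sum_norm_le)
    also have "\<dots> \<le> (\<Sum>j<n. M * y j)"
      using M[of k] carrier_matD[OF B] carrier_matD[OF Bk] i0 y by (intro sum_mono) (auto simp: norm_mult norm_bound_def intro!: mult_right_mono)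
    finally show ?thesis using u(2) i0 by force
  qed
  have "1 < c / d" using d d0 by simp
  then obtain k where "(\<Sum>j<n. M * y j) / y i0 < (c / d) ^ k"
    using real_arch_pow by blast
  then have "(\<Sum>j<n. M * y j) < (c / d) ^ k * y i0" using i0 by (simp add: field_simps)
  with bound[of k] show False by simp
qed

section \<open>Eigenvalues of the clique tensor\<close>

text \<open>Each set of size \<open>s\<close> has \<open>s!\<close> orderings, all with the same
  product. This factor will cancel the normalisation \<open>1 / fact (r - 1)\<close> of the
  tensor.\<close>

lemma sum_distinct_lists_prod:
  fixes y :: "'a \<Rightarrow> 'b::{comm_semiring_1,semiring_char_0}"
  assumes "finite \<K>" "\<And>K. K \<in> \<K> \<Longrightarrow> finite K \<and> card K = s"
  shows "(\<Sum>js\<in>{js. distinct js \<and> set js \<in> \<K>}. \<Prod>j\<leftarrow>js. y j) = fact s * (\<Sum>K\<in>\<K>. \<Prod>v\<in>K. y v)"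
proof -
  have "{js. distinct js \<and> set js \<in> \<K>} = (\<Union>K\<in>\<K>. permutations_of_set K)"
    by (auto simp: permutations_of_set_def)
  then have "(\<Sum>js\<in>{js. distinct js \<and> set js \<in> \<K>}. \<Prod>j\<leftarrow>js. y j)
      = (\<Sum>K\<in>\<K>. \<Sum>js\<in>permutations_of_set K. \<Prod>j\<leftarrow>js. y j)"
    by (simp only:) (rule sum.UNION_disjoint, use assms in \<open>auto simp: permutations_of_set_def[symmetric]\<close>,
      auto simp: permutations_of_set_def)
  also have "\<dots> = (\<Sum>K\<in>\<K>. fact s * (\<Prod>v\<in>K. y v))"
  proof (rule sum.cong)
    fix K assume K: "K \<in> \<K>"
    have "(\<Sum>js\<in>permutations_of_set K. \<Prod>j\<leftarrow>js. y j) = (\<Sum>js\<in>permutations_of_set K. \<Prod>v\<in>K. y v)"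
      by (rule sum.cong) (auto simp: permutations_of_set_def prod.distinct_set_conv_list)
    then show "(\<Sum>js\<in>permutations_of_set K. \<Prod>j\<leftarrow>js. y j) = fact s * (\<Prod>v\<in>K. y v)"
      using assms(2)[OF K] by simp
  qed simp
  finally show ?thesis by (simp add: sum_distrib_left)
qed

lemma card_clique_le_clique_number:
  assumes "finite V" "K \<subseteq> V" "clique K E"
  shows "card K \<le> clique_number V E"
  unfolding clique_number_def using assms by (intro Max_ge) auto


text \<open>Tensor indices are numbers while cliques live in \<open>V\<close>; pulling the edge set
  back along the numbering \<open>f\<close> moves cliques to the index side.\<close>

lemma clique_image_iff:
  assumes "inj_on f A" "K \<subseteq> A"
  shows "clique (f ` K) E \<longleftrightarrow> clique K {e. f ` e \<in> E}"
proof -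
  have "f v = f w \<longleftrightarrow> v = w" if "v \<in> K" "w \<in> K" for v w
    using that assms by (auto dest: inj_onD)
  then show ?thesis by (simp add: clique_def)
qed

text \<open>The unit vector at 0 is an eigenvector: its products vanish unless all entries of
  \<open>js\<close> are 0, and then the indices give at most two vertices, too few for an
  \<open>r\<close>-clique. This makes the set of eigenvalues nonempty.\<close>

lemma clique_tensor_eigenvalue_0:
  assumes "0 < card V" "3 \<le> r"
  shows "tensor_eigenvalue r (card V) (clique_tensor r V E) 0"
proof -
  let ?n = "card V" and ?x = "unit_vec (card V) 0 :: complex vec"
  have zero: "clique_tensor r V E (i # js) * (\<Prod>j\<leftarrow>js. ?x $ j) = 0"
    if js: "length js = r - 1" "set js \<subseteq> {..<?n}" for i js
  proof (cases "\<exists>j\<in>set js. j \<noteq> 0")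
    case True
    then obtain j where "j \<in> set js" "j \<noteq> 0" by blast
    moreover then have "?x $ j = 0" using js(2) by auto
    ultimately have "(\<Prod>j\<leftarrow>js. ?x $ j) = 0"
      by (auto simp: prod_list_zero_iff image_iff)
    then show ?thesis by simp
  next
    case False
    then have "from_nat_into V ` set (i # js) \<subseteq> {from_nat_into V i, from_nat_into V 0}" by auto
    then have "card (from_nat_into V ` set (i # js)) \<le> card {from_nat_into V i, from_nat_into V 0}"
      by (rule card_mono[rotated]) simp
    also have "\<dots> \<le> 2" by (simp add: card_insert_if)
    finally show ?thesis using assms(2) by (simp add: clique_tensor_def r_cliques_def)
  qed
  have "tensor_apply r ?n (clique_tensor r V E) ?x = 0 \<cdot>\<^sub>v map_vec (\<lambda>z. z ^ (r - 1)) ?x"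
    unfolding tensor_apply_def
    by (rule eq_vecI) (auto intro!: sum.neutral zero)
  moreover have "?x \<noteq> 0\<^sub>v ?n"
    using assms(1) by (metis index_unit_vec(1) index_zero_vec(1) zero_neq_one)
  ultimately show ?thesis
    unfolding tensor_eigenvalue_def by (intro bexI[of _ ?x]) auto
qed

text \<open>A nonzero entry in row \<open>i\<close> comes from an \<open>r\<close>-clique through
  \<open>f i\<close>. The other indices form an \<open>(r-1)\<close>-clique in \<open>N\<close>,
  since edges within an \<open>r\<close>-clique survive the deletion. Its \<open>(r-1)!\<close>
  orderings cancel the normalisation.\<close>

lemma norm_clique_tensor_apply_le:
  fixes V :: "'a set" and E :: "'a set set"
  assumes V: "finite V" and r: "0 < r" and i: "i < card V"
  defines "f \<equiv> from_nat_into V"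
  defines "N \<equiv> {j. j < card V \<and> {f i, f j} \<in> edges_in_r_cliques r V E}"
  shows "norm (tensor_apply r (card V) (clique_tensor r V E) x $ i)
    \<le> clique_sum {e. f ` e \<in> E} (\<lambda>j. norm (x $ j)) N (r - 1)"
proof -
  let ?n = "card V" and ?E = "{e. f ` e \<in> E}" and ?y = "\<lambda>j. norm (x $ j)"
  let ?J = "{js. length js = r - 1 \<and> set js \<subseteq> {..<?n}}"
  let ?D = "{js. distinct js \<and> set js \<in> r_cliques (r - 1) N ?E}"
  have bij: "bij_betw f {..<?n} V"
    unfolding f_def by (rule bij_betw_from_nat_into_finite[OF V])
  then have inj: "inj_on f {..<?n}" by (rule bij_betw_imp_inj_on)
  have finJ: "finite ?J"
    using finite_lists_length_eq[of "{..<?n}" "r - 1"] by (simp add: conj_commute)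
  have finN: "finite N" by (simp add: N_def)
  have DJ: "?D \<subseteq> ?J"
    by (auto simp: r_cliques_def N_def distinct_card[symmetric])
  have support: "js \<in> ?D" if js: "js \<in> ?J" and "clique_tensor r V E (i # js) \<noteq> 0" for js
  proof -
    let ?L = "insert i (set js)"
    have L: "f ` ?L \<in> r_cliques r V E"
      using that(2) by (auto simp: clique_tensor_def f_def split: if_splits)
    have Ln: "?L \<subseteq> {..<?n}" using js i by auto
    have "clique (f ` ?L) E" using L unfolding r_cliques_def by blast
    then have clL: "clique ?L ?E"
      using clique_image_iff[OF inj Ln] by blast
    \<comment> \<open>Pigeonhole: \<open>r\<close> distinct vertices come from \<open>i\<close> and
      only \<open>r - 1\<close> list entries, so the list has no repetition and avoids
      \<open>i\<close>.\<close>
    have "r \<le> card ?L"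
      using L card_image_le[of ?L f] by (simp add: r_cliques_def)
    moreover have "card (set js) \<le> r - 1" using js card_length[of js] by simp
    ultimately have card: "card (set js) = r - 1" "i \<notin> set js"
      using r by (auto simp: card_insert_if split: if_splits)
    have "set js \<subseteq> N"
    proof
      fix j assume j: "j \<in> set js"
      then have "{f i, f j} \<in> E" using clL card(2) by (auto simp: clique_def)
      moreover have "{f i, f j} \<subseteq> f ` ?L" using j by auto
      ultimately have "{f i, f j} \<in> edges_in_r_cliques r V E"
        using L unfolding edges_in_r_cliques_def by blast
      then show "j \<in> N" using j js by (auto simp: N_def)
    qed
    moreover have "clique (set js) ?E" using clL by (auto simp: clique_def)
    moreover have "distinct js" using card(1) js by (simp add: card_distinct)
    ultimately show ?thesis using card(1) by (auto simp: r_cliques_def)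
  qed
  have "tensor_apply r ?n (clique_tensor r V E) x $ i
      = (\<Sum>js\<in>?J. clique_tensor r V E (i # js) * (\<Prod>j\<leftarrow>js. x $ j))"
    using i by (simp add: tensor_apply_def)
  also have "\<dots> = (\<Sum>js\<in>?D. clique_tensor r V E (i # js) * (\<Prod>j\<leftarrow>js. x $ j))"
    by (rule sum.mono_neutral_right[OF finJ DJ]) (use support in force)
  finally have "norm (tensor_apply r ?n (clique_tensor r V E) x $ i)
      = norm (\<Sum>js\<in>?D. clique_tensor r V E (i # js) * (\<Prod>j\<leftarrow>js. x $ j))"
    by simp
  also have "\<dots> \<le> (\<Sum>js\<in>?D. 1 / fact (r - 1) * (\<Prod>j\<leftarrow>js. ?y j))"
  proof (rule sum_norm_le)
    fix js
    have "norm (\<Prod>j\<leftarrow>js. x $ j) = (\<Prod>j\<leftarrow>js. ?y j)"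
      by (induction js) (simp_all add: norm_mult)
    moreover have "0 \<le> (\<Prod>j\<leftarrow>js. ?y j)"
      by (induction js) simp_all
    ultimately show "norm (clique_tensor r V E (i # js) * (\<Prod>j\<leftarrow>js. x $ j))
        \<le> 1 / fact (r - 1) * (\<Prod>j\<leftarrow>js. ?y j)"
      by (simp add: norm_mult clique_tensor_def norm_divide)
  qed
  also have "\<dots> = 1 / fact (r - 1) * (\<Sum>js\<in>?D. \<Prod>j\<leftarrow>js. ?y j)"
    by (simp add: sum_distrib_left)
  also have "(\<Sum>js\<in>?D. \<Prod>j\<leftarrow>js. ?y j) = fact (r - 1) * clique_sum ?E ?y N (r - 1)"
    unfolding clique_sum_def
    by (rule sum_distinct_lists_prod) (auto simp: finite_r_cliques[OF finN], auto simp: r_cliques_def)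
  finally show ?thesis by simp
qed

section \<open>The bound for a single eigenvalue\<close>

text \<open>Joining \<open>v\<close> to \<open>K\<close> gives a clique with one more vertex;
  \<open>v\<close> is not in \<open>K\<close> because \<open>{v}\<close> is not an edge.\<close>

lemma card_clique_neighbourhood_le:
  assumes "finite V" "E \<subseteq> nsets V 2" "v \<in> V" "K \<subseteq> V" "clique K E" "\<And>u. u \<in> K \<Longrightarrow> {v, u} \<in> E"
  shows "card K \<le> clique_number V E - 1"
proof -
  have "{v} \<notin> E" using assms(2) by (auto simp: nsets_def)
  have "v \<notin> K" using assms(6)[of v] \<open>{v} \<notin> E\<close> by auto
  have 2: "clique (insert v K) E"
    unfolding clique_def
  proof (intro ballI impI)
    fix u w assume "u \<in> insert v K" "w \<in> insert v K" "u \<noteq> w"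
    then consider "u = v" "w \<in> K" | "w = v" "u \<in> K" | "u \<in> K" "w \<in> K" by blast
    then show "{u, w} \<in> E"
    proof cases
      case 2
      then show ?thesis using assms(6)[of u] by (simp add: insert_commute)
    qed (use assms(5,6) \<open>u \<noteq> w\<close> in \<open>simp_all add: clique_def\<close>)
  qed
  have 1: "finite K" using assms(1,4) by (rule finite_subset[rotated])
  have "card (insert v K) \<le> clique_number V E"
    by (rule card_clique_le_clique_number) (use assms(1,3,4) 2 in simp_all)
  then show ?thesis using 1 \<open>v \<notin> K\<close> by simp
qed

lemma clique_tensor_eigenvalue_bound:
  fixes V :: "'a set" and E :: "'a set set"
  assumes V: "finite V" and E: "E \<subseteq> nsets V 2" and r: "2 \<le> r" "r \<le> clique_number V E"
    and ev: "tensor_eigenvalue r (card V) (clique_tensor r V E) \<mu>"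
  shows "norm \<mu> \<le> graph_spectral_radius V (edges_in_r_cliques r V E) ^ (r - 1)
    * real ((clique_number V E - 1) choose (r - 1)) / real (clique_number V E - 1) ^ (r - 1)"
proof -
  define n where "n = card V"
  define f where "f = from_nat_into V"
  define s where "s = r - 1"
  define k where "k = clique_number V E - 1"
  define b where "b = real (k choose s)"
  define a :: "nat \<Rightarrow> nat \<Rightarrow> real" where
    "a i j = (if {f i, f j} \<in> edges_in_r_cliques r V E then 1 else 0)" for i j
  have s: "0 < s" "s \<le> k" using r by (auto simp: s_def k_def)
  \<comment> \<open>Positivity of the binomial coefficient comes from
    \<open>r \<le> \<omega>\<close>; it allows division by \<open>b\<close> when \<open>c\<close> is
    defined.\<close>
  then have b: "0 < b" by (simp add: b_def zero_less_binomial_iff)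
  have k: "0 < k" using s by simp
  obtain x where x: "x \<in> carrier_vec n" "x \<noteq> 0\<^sub>v n"
      "tensor_apply r n (clique_tensor r V E) x = \<mu> \<cdot>\<^sub>v map_vec (\<lambda>z. z ^ s) x"
    using ev unfolding tensor_eigenvalue_def n_def s_def by blast
  define y where "y = (\<lambda>j. norm (x $ j))"
  have "\<exists>i<n. x $ i \<noteq> 0"
  proof (rule ccontr)
    assume "\<not> ?thesis"
    then have "x = 0\<^sub>v n" using x(1) by (intro eq_vecI) auto
    with x(2) show False ..
  qed
  then obtain i0 where i0: "i0 < n" "0 < y i0" by (auto simp: y_def)
  have bij: "bij_betw f {..<n} V"
    unfolding f_def n_def by (rule bij_betw_from_nat_into_finite[OF V])
  have row: "norm \<mu> * y i ^ s \<le> b * ((\<Sum>j<n. a i j * y j) / real k) ^ s" if i: "i < n" for i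
  proof -
    define N where "N = {j. j < n \<and> {f i, f j} \<in> edges_in_r_cliques r V E}"
    have "norm \<mu> * y i ^ s = norm (tensor_apply r n (clique_tensor r V E) x $ i)"
      unfolding x(3) using i x(1) by (simp add: norm_mult norm_power y_def)
    also have "\<dots> \<le> clique_sum {e. f ` e \<in> E} y N s"
      unfolding n_def f_def N_def s_def y_def
      by (rule norm_clique_tensor_apply_le) (use V r i in \<open>auto simp: n_def\<close>)
    also have "\<dots> \<le> real (k choose s) * ((\<Sum>j\<in>N. y j) / real k) ^ s"
    proof (rule weighted_motzkin_straus)
      fix K assume K: "K \<subseteq> N" "clique K {e. f ` e \<in> E}"
      have Kn: "K \<subseteq> {..<n}" using K(1) by (auto simp: N_def)
      have inj: "inj_on f {..<n}" using bij by (rule bij_betw_imp_inj_on)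
      have "card K = card (f ` K)"
        using inj Kn by (metis card_image inj_on_subset)
      also have "\<dots> \<le> k"
        unfolding k_def
      proof (rule card_clique_neighbourhood_le[OF V E])
        show "f i \<in> V" using bij i by (auto simp: bij_betw_def)
        show "f ` K \<subseteq> V" using bij Kn by (auto simp: bij_betw_def)
        show "clique (f ` K) E" using clique_image_iff[OF inj Kn] K(2) by simp
        show "{f i, u} \<in> E" if "u \<in> f ` K" for u
          using that K(1) by (auto simp: N_def edges_in_r_cliques_def)
      qed
      finally show "card K \<le> k" .
    qed (auto simp: N_def y_def)
    \<comment> \<open>The total weight on \<open>N\<close> is row \<open>i\<close> of the reduced
      adjacency matrix applied to \<open>y\<close>.\<close>
    also have "(\<Sum>j\<in>N. y j) = (\<Sum>j<n. a i j * y j)"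
      by (rule sum.mono_neutral_cong_left) (auto simp: N_def a_def)
    finally show ?thesis by (simp add: b_def)
  qed
  \<comment> \<open>Chosen so that \<open>norm \<mu> = b * (c / k) ^ s\<close>; the row inequality
    then compares two \<open>s\<close>-th powers of nonnegative numbers, and taking roots makes it
    linear in \<open>y\<close>.\<close>
  define c where "c = root s (norm \<mu> / b) * real k"
  have cs: "c ^ s = norm \<mu> / b * real k ^ s"
    using s b by (simp add: c_def power_mult_distrib)
  have c0: "0 \<le> c" using s b by (simp add: c_def)
  have "c * y i \<le> (\<Sum>j<n. a i j * y j)" if i: "i < n" for i
  proof (rule power_mono_iff[THEN iffD1])
    show "(c * y i) ^ s \<le> (\<Sum>j<n. a i j * y j) ^ s"
      using row[OF i] b k by (simp add: power_mult_distrib cs power_divide field_simps)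
  qed (use s c0 in \<open>auto simp: y_def a_def intro!: sum_nonneg\<close>)
  then have "c \<le> spectral_radius (mat n n (\<lambda>(i, j). complex_of_real (a i j)))"
    by (intro collatz_wielandt_lower_bound[of a n y i0] i0) (auto simp: a_def y_def)
  also have "mat n n (\<lambda>(i, j). complex_of_real (a i j)) = adjacency_matrix V (edges_in_r_cliques r V E)"
    by (rule eq_matI) (auto simp: adjacency_matrix_def a_def n_def f_def)
  finally have "c ^ s \<le> graph_spectral_radius V (edges_in_r_cliques r V E) ^ s"
    using c0 unfolding graph_spectral_radius_def by (rule power_mono)
  then have "norm \<mu> \<le> graph_spectral_radius V (edges_in_r_cliques r V E) ^ s * b / real k ^ s"
    using b k by (simp add: cs field_simps)
  then show ?thesis by (simp add: s_def b_def k_def)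
qed

theorem theorem4p4:
  fixes V :: "'a set" and E :: "'a set set" and r :: nat
  assumes "finite_simple_graph V E"
    and "3 \<le> r" and "r \<le> clique_number V E"
  shows "clique_spectral_radius r V E
    \<le> graph_spectral_radius V (edges_in_r_cliques r V E) ^ (r - 1)
       * real ((clique_number V E - 1) choose (r - 1))
       * real (clique_number V E - 1) powi (- int (r - 1))"
proof -
  have V: "finite V" and E: "E \<subseteq> nsets V 2"
    using assms(1) by (auto simp: finite_simple_graph_def)
  have "V \<noteq> {}"
  proof
    assume "V = {}"
    then have "{K. K \<subseteq> V \<and> clique K E} = {{}}" by (auto simp: clique_def)
    then have "clique_number V E = 0" by (simp add: clique_number_def)
    with assms(2,3) show False by simp
  qed
  then have "0 < card V" using V by (simp add: card_gt_0_iff)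
  \<comment> \<open>The supremum of a nonempty set is at most any upper bound; the supremum of the
    empty set would be an unspecified real.\<close>
  then have nonempty: "norm ` Collect (tensor_eigenvalue r (card V) (clique_tensor r V E)) \<noteq> {}"
    using clique_tensor_eigenvalue_0[OF _ assms(2)] by blast
  have "2 \<le> r" using assms(2) by simp
  note bound = clique_tensor_eigenvalue_bound[OF V E this assms(3)]
  have "clique_spectral_radius r V E
    \<le> graph_spectral_radius V (edges_in_r_cliques r V E) ^ (r - 1)
      * real ((clique_number V E - 1) choose (r - 1)) / real (clique_number V E - 1) ^ (r - 1)"
    unfolding clique_spectral_radius_def tensor_spectral_radius_def
  proof (rule cSup_least[OF nonempty], elim imageE, unfold mem_Collect_eq)
    fix t \<mu>
    assume t: "t = norm \<mu>" and "tensor_eigenvalue r (card V) (clique_tensor r V E) \<mu>"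
    then show "t \<le> graph_spectral_radius V (edges_in_r_cliques r V E) ^ (r - 1)
      * real ((clique_number V E - 1) choose (r - 1)) / real (clique_number V E - 1) ^ (r - 1)"
      unfolding t by (intro bound)
  qed
  then show ?thesis
    by (simp only: power_int_minus power_int_of_nat divide_inverse)
qed

end
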